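(* Let $n\ge 1$ and $\lambda\in[1/(n+1),1/2]$. Let $P\subseteq\mathbb{R}^n$ be a polytope such that all of its $(n-1)$-dimensional faces are $\lambda$-vertex generated. Let $\ell\subseteq\mathbb{R}^n$ be an origin symmetric line segment and let $P'=P+\ell$. Then $$P'\setminus\left((1-\lambda)P'+\lambda V(P')\right)\subseteq P\setminus\left((1-\lambda)P+\lambda V(P)\right).$$ In particular, if $P$ is $\lambda$-vertex generated (so that the right hand side is empty), then so is $P+\ell$ for any segment $\ell$.
   Context: $V(P)$ denotes the set of vertices of a polytope $P\subset\mathbb{R}^n$; $A+B=\{a+b: a\in A,b\in B\}$ is the Minkowski sum. For a polytope $P\subset\mathbb{R}^n$ let $\lambda(P)=\sup\{\lambda: P=(1-\lambda)P+\lambda V(P)\}$. $P$ is called $\lambda$-vertex generated if $\lambda(P)\ge\lambda$.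
   Formalization: If dim P < n-1, P itself is additionally assumed λ-vertex generated: there P has no (n-1)-dimensional faces and the inclusion can fail (n=4, λ=1/2, P a triangle, ℓ not parallel to its plane); P counts as a face of itself when dim P = n-1. *)

theory Defs
  imports "HOL-Analysis.Analysis" "HOL-Library.Set_Algebras"
begin

definition vertices :: "'a::real_vector set \<Rightarrow> 'a set"
  where "vertices P = {v. v extreme_point_of P}"

text \<open>The set \<open>(1 - \<lambda>)P + \<lambda>V(P)\<close>; the addition of sets is the Minkowski sum.\<close>

definition vertex_comb :: "real \<Rightarrow> 'a::real_vector set \<Rightarrow> 'a set"
  where "vertex_comb l P = (\<lambda>x. (1 - l) *\<^sub>R x) ` P + (\<lambda>x. l *\<^sub>R x) ` vertices P"

text \<open>The supremum is taken in the extended reals: if \<open>P\<close> is a single point, then every real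
  \<open>\<lambda>\<close> satisfies the equation, and the real-valued \<^const>\<open>Sup\<close> would be unspecified.
  If \<open>P\<close> has at least two points, the equation forces \<open>0 \<le> \<lambda> \<le> 1\<close>.\<close>

definition vertex_gen_number :: "'a::real_vector set \<Rightarrow> ereal"
  where "vertex_gen_number P = Sup (ereal ` {l. P = vertex_comb l P})"

definition vertex_generated :: "real \<Rightarrow> 'a::real_vector set \<Rightarrow> bool"
  where "vertex_generated l P \<longleftrightarrow> vertex_gen_number P \<ge> ereal l"

end

theory Submission
  imports Defs
begin

text \<open>Let \<open>x\<close> be a point of \<open>P + [-u, u]\<close> outside \<open>P\<close>; up to the sign of \<open>u\<close> we have \<open>x = a + s u\<close>
  with \<open>0 \<le> s \<le> 1\<close>, where \<open>a\<close> is a point at which the direction \<open>u\<close> leaves \<open>P\<close>. One of the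
  halfspaces cutting out \<open>P\<close> is tight at \<open>a\<close> and is left in the direction \<open>u\<close>. Its face is vertex
  generated: it is a facet if \<open>P\<close> is full-dimensional, and otherwise \<open>P\<close> itself is vertex generated,
  which passes to faces as \<open>\<lambda> > 0\<close>. So \<open>a = (1 - \<lambda>) q + \<lambda> v\<close> with a vertex \<open>v\<close> in that face. The
  face translated by \<open>u\<close> is a face of the sum, hence \<open>v + u\<close> is a vertex, and
  \<open>x = (1 - \<lambda>)(q + k u) + \<lambda>(v + u)\<close> with \<open>k = (s - \<lambda>) / (1 - \<lambda>)\<close>, where \<open>\<bar>k\<bar> \<le> 1\<close> as \<open>\<lambda> \<le> 1/2\<close>.
  A point of \<open>(1 - \<lambda>)P + \<lambda>V(P)\<close> stays covered because for each vertex \<open>v\<close> of \<open>P\<close> one of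
  \<open>v \<plusminus> u\<close> is a vertex of the sum.\<close>

section \<open>Dependence on the parameter, and the supremum in the definition\<close>

lemma mem_vertex_comb:
  "x \<in> vertex_comb l P \<longleftrightarrow> (\<exists>p\<in>P. \<exists>v\<in>vertices P. x = (1 - l) *\<^sub>R p + l *\<^sub>R v)"
  by (auto simp: vertex_comb_def set_plus_def)

lemma vertices_subset: "vertices P \<subseteq> P"
  by (auto simp: vertices_def extreme_point_of_def)

lemma vertex_comb_subset:
  assumes "convex P" "0 \<le> l" "l \<le> 1"
  shows "vertex_comb l P \<subseteq> P"
  using assms vertices_subset[of P] by (auto simp: mem_vertex_comb intro!: convexD)

text \<open>The excess weight \<open>m - l\<close> of the vertex is moved to the point of
  \<open>P\<close>, which stays in \<open>P\<close> by convexity as long as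
  \<open>m \<le> 1\<close>. The supremum runs over all reals, so \<open>m > 1\<close> has to be
  treated too.\<close>

lemma vertex_comb_antimono:
  fixes P :: "'a::real_vector set"
  assumes "convex P" "0 \<le> l" "l < 1" "l \<le> m" and x: "x \<in> P" "x \<in> vertex_comb m P"
  shows "x \<in> vertex_comb l P"
proof -
  obtain p v where p: "p \<in> P" and v: "v \<in> vertices P" and xe: "x = (1 - m) *\<^sub>R p + m *\<^sub>R v"
    using x by (auto simp: mem_vertex_comb)
  have vP: "v \<in> P"
    using v vertices_subset by blast
  show ?thesis
  proof (cases "m \<le> 1")
    case True
    let ?q = "((1 - m) / (1 - l)) *\<^sub>R p + ((m - l) / (1 - l)) *\<^sub>R v"
    have "?q \<in> P"
      using assms True p vP by (intro convexD) (auto simp: divide_simps)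
    moreover have "(1 - l) *\<^sub>R ?q = (1 - m) *\<^sub>R p + (m - l) *\<^sub>R v"
      using \<open>l < 1\<close> by (simp add: scaleR_add_right)
    then have "x = (1 - l) *\<^sub>R ?q + l *\<^sub>R v"
      by (simp add: xe scaleR_left_diff_distrib)
    ultimately show ?thesis
      using v by (auto simp: mem_vertex_comb)
  next
    case False
    \<comment> \<open>Here \<open>v\<close> lies strictly between \<open>x\<close> and \<open>p\<close>, which extremality only allows if \<open>x = p\<close>.\<close>
    have "v = (1 - 1 / m) *\<^sub>R p + (1 / m) *\<^sub>R x"
      using False by (simp add: xe algebra_simps flip: scaleR_add_left)
    then have "v \<in> open_segment p x" if "p \<noteq> x"
      using that False by (auto simp: in_segment intro!: exI[of _ "1 / m"])
    then have "p = x"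
      using v p x by (auto simp: vertices_def extreme_point_of_def)
    then have "x = (1 - m) *\<^sub>R x + m *\<^sub>R v"
      using xe by simp
    then have "x = v"
      using False \<open>0 \<le> l\<close> by (auto simp: algebra_simps)
    then have "x = (1 - l) *\<^sub>R x + l *\<^sub>R v"
      by (simp add: algebra_simps)
    then show ?thesis
      using v \<open>x \<in> P\<close> by (auto simp: mem_vertex_comb)
  qed
qed

text \<open>Solving \<open>x = (1 - m) p + m v\<close> for \<open>p\<close> gives
  \<open>?f v m\<close>, which is continuous in \<open>m\<close> near \<open>l < 1\<close>. As
  \<open>P\<close> is closed and has finitely many vertices, missing \<open>P\<close> for every
  \<open>v\<close> is an open condition on \<open>m\<close>.\<close>

lemma eventually_not_in_vertex_comb:
  fixes P :: "'a::euclidean_space set"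
  assumes "polytope P" "l < 1" and x: "x \<notin> vertex_comb l P"
  shows "\<forall>\<^sub>F m in nhds l. x \<notin> vertex_comb m P"
proof -
  let ?f = "\<lambda>v m. (1 / (1 - m)) *\<^sub>R (x - m *\<^sub>R v)"
  have f: "?f v m \<in> P" if "m < 1" "x = (1 - m) *\<^sub>R p + m *\<^sub>R v" "p \<in> P" for m v p
    using that by simp
  have "\<forall>\<^sub>F m in nhds l. ?f v m \<in> - P" if "v \<in> vertices P" for v
  proof -
    have "?f v l \<notin> P"
    proof
      assume "?f v l \<in> P"
      moreover have "x = (1 - l) *\<^sub>R ?f v l + l *\<^sub>R v"
        using \<open>l < 1\<close> by simp
      ultimately show False
        using x that by (auto simp: mem_vertex_comb)
    qed
    moreover have "open (- P)"
      using assms by (simp add: polytope_imp_closed open_Compl)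
    moreover have "isCont (?f v) l"
      using \<open>l < 1\<close> by (intro continuous_intros) auto
    ultimately show ?thesis
      by (subst eventually_nhds_conv_at) (auto simp: isCont_def dest: topological_tendstoD)
  qed
  moreover have "finite (vertices P)"
    using assms by (simp add: vertices_def finite_polyhedron_extreme_points polytope_imp_polyhedron)
  ultimately have "\<forall>\<^sub>F m in nhds l. \<forall>v\<in>vertices P. ?f v m \<in> - P"
    by (simp add: eventually_ball_finite)
  moreover have "\<forall>\<^sub>F m in nhds l. m < 1"
    using \<open>l < 1\<close> by (auto simp: eventually_nhds intro!: exI[of _ "{..<1}"])
  ultimately show ?thesis
    by eventually_elim (use f in \<open>auto simp: mem_vertex_comb\<close>)
qed

text \<open>The supremum is effectively attained. A point not covered at \<open>l\<close> stays
  uncovered at nearby parameters by openness and at all larger ones by monotonicity, so no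
  admissible parameter exceeds \<open>l - e\<close>.\<close>

lemma vertex_generated_iff:
  fixes P :: "'a::euclidean_space set"
  assumes P: "polytope P" and l: "0 \<le> l" "l < 1"
  shows "vertex_generated l P \<longleftrightarrow> P \<subseteq> vertex_comb l P"
proof
  assume "P \<subseteq> vertex_comb l P"
  with vertex_comb_subset[of P l] P l have "P = vertex_comb l P"
    by (simp add: polytope_imp_convex subset_antisym)
  then show "vertex_generated l P"
    by (auto simp: vertex_generated_def vertex_gen_number_def intro!: Sup_upper)
next
  assume gen: "vertex_generated l P"
  show "P \<subseteq> vertex_comb l P"
  proof (rule subsetI, rule ccontr)
    fix x assume x: "x \<in> P" "x \<notin> vertex_comb l P"
    then obtain e where e: "e > 0" "\<And>m. dist m l < e \<Longrightarrow> x \<notin> vertex_comb m P"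
      using eventually_not_in_vertex_comb[OF P l(2)] by (auto simp: eventually_nhds_metric)
    have "ereal (l - e) < ereal l"
      using e by simp
    also have "\<dots> \<le> Sup (ereal ` {l. P = vertex_comb l P})"
      using gen by (simp add: vertex_generated_def vertex_gen_number_def)
    finally obtain m where m: "l - e < m" "P = vertex_comb m P"
      by (auto simp: less_Sup_iff)
    then have "x \<in> vertex_comb m P"
      using x by simp
    moreover have "dist m l < e" if "m < l"
      using that m by (simp add: dist_real_def)
    ultimately show False
      using e x l vertex_comb_antimono[OF polytope_imp_convex[OF P], of l m x] by (meson not_le)
  qed
qed

section \<open>Translations, faces and Minkowski sums\<close>

text \<open>Reduces an arbitrary segment to its origin symmetric translate.\<close>

lemma vertex_comb_translation:
  fixes P :: "'a::real_vector set"
  shows "vertex_comb l ((+) a ` P) = (+) a ` vertex_comb l P"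
proof -
  have "vertices ((+) a ` P) = (+) a ` vertices P"
    using extreme_points_of_translation[of a P] by (simp add: vertices_def)
  moreover have "(1 - l) *\<^sub>R (a + p) + l *\<^sub>R (a + v) = a + ((1 - l) *\<^sub>R p + l *\<^sub>R v)" for p v
    by (simp add: algebra_simps)
  ultimately show ?thesis
    by (fastforce simp: mem_vertex_comb image_iff)
qed

text \<open>For \<open>0 < l < 1\<close> the point \<open>x\<close> is interior to the segment from
  \<open>p\<close> to \<open>v\<close> unless these coincide, so a face containing \<open>x\<close>
  contains both.\<close>

lemma vertex_comb_face:
  fixes P :: "'a::euclidean_space set"
  assumes "F face_of P" "0 < l" "l < 1" and x: "x \<in> F" "x \<in> vertex_comb l P"
  shows "x \<in> vertex_comb l F"
proof -
  obtain p v where p: "p \<in> P" and v: "v \<in> vertices P" and xe: "x = (1 - l) *\<^sub>R p + l *\<^sub>R v"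
    using x by (auto simp: mem_vertex_comb)
  have vP: "v \<in> P"
    using v vertices_subset by blast
  have "p \<in> F \<and> v \<in> F"
  proof (cases "p = v")
    case True
    then show ?thesis
      using x xe by (simp flip: scaleR_add_left)
  next
    case False
    then have "x \<in> open_segment p v"
      using xe assms by (auto simp: in_segment)
    then show ?thesis
      using assms p vP by (auto simp: face_of_def)
  qed
  then show ?thesis
    using v xe assms extreme_point_of_face[OF assms(1)] by (auto simp: mem_vertex_comb vertices_def)
qed

lemma polytope_plus:
  fixes P Q :: "'a::real_vector set"
  assumes "polytope P" "polytope Q"
  shows "polytope (P + Q)"
  using assms unfolding polytope_def by (metis convex_hull_set_plus finite_set_plus)

lemma symmetric_segment_eq:
  fixes u :: "'a::real_vector"
  shows "closed_segment (- u) u = (\<lambda>t. t *\<^sub>R u) ` {-1..1}"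
proof (intro subset_antisym subsetI)
  fix x assume "x \<in> closed_segment (- u) u"
  then obtain t where "0 \<le> t" "t \<le> 1" "x = (1 - t) *\<^sub>R (- u) + t *\<^sub>R u"
    by (auto simp: in_segment)
  then show "x \<in> (\<lambda>t. t *\<^sub>R u) ` {-1..1}"
    by (intro image_eqI[of _ _ "2 * t - 1"]) (auto simp: algebra_simps simp flip: scaleR_2)
next
  fix x assume "x \<in> (\<lambda>t. t *\<^sub>R u) ` {-1..1}"
  then obtain t where "-1 \<le> t" "t \<le> 1" "x = t *\<^sub>R u"
    by auto
  moreover have "(1 - (t + 1) / 2) *\<^sub>R (- u) + ((t + 1) / 2) *\<^sub>R u = t *\<^sub>R u"
    by (simp add: algebra_simps flip: scaleR_add_left scaleR_diff_left)
  ultimately show "x \<in> closed_segment (- u) u"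
    by (auto simp: in_segment intro!: exI[of _ "(t + 1) / 2"])
qed

lemma mem_plus_symmetric_segment:
  fixes u :: "'a::real_vector"
  shows "x \<in> P + closed_segment (- u) u \<longleftrightarrow> (\<exists>p\<in>P. \<exists>t. \<bar>t\<bar> \<le> 1 \<and> x = p + t *\<^sub>R u)"
  by (fastforce simp: symmetric_segment_eq set_plus_def abs_le_iff)

section \<open>Vertices of a polytope plus a segment\<close>

text \<open>A point of the sum maximizes \<open>c\<close> only if both summands do. Since
  \<open>c \<bullet> u > 0\<close>, the segment contributes exactly \<open>u\<close>, and the
  maximal face of the sum is the one of \<open>P\<close> translated by \<open>u\<close>.\<close>

lemma vertex_plus_segment:
  fixes P :: "'a::euclidean_space set"
  assumes "convex P" and v: "v \<in> vertices P" and c: "\<And>x. x \<in> P \<Longrightarrow> c \<bullet> x \<le> c \<bullet> v" and "0 < c \<bullet> u"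
  shows "v + u \<in> vertices (P + closed_segment (- u) u)" (is "_ \<in> vertices ?P'")
proof -
  let ?F = "P \<inter> {x. c \<bullet> x = c \<bullet> v}"
  let ?G = "?P' \<inter> {x. c \<bullet> x = c \<bullet> v + c \<bullet> u}"
  have le: "t * (c \<bullet> u) \<le> c \<bullet> u" if "\<bar>t\<bar> \<le> 1" for t
    using that \<open>0 < c \<bullet> u\<close> by simp
  have "?G face_of ?P'"
  proof (rule face_of_Int_supporting_hyperplane_le)
    show "convex ?P'"
      using \<open>convex P\<close> by (intro convex_set_plus) auto
    show "c \<bullet> x \<le> c \<bullet> v + c \<bullet> u" if "x \<in> ?P'" for x
      using that c le by (auto simp: mem_plus_symmetric_segment inner_add_right intro!: add_mono)
  qed
  moreover have "?F face_of P"
    using assms by (intro face_of_Int_supporting_hyperplane_le)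
  moreover have "?G = (+) u ` ?F"
  proof (intro subset_antisym subsetI)
    fix x assume "x \<in> ?G"
    then obtain p t where p: "p \<in> P" "\<bar>t\<bar> \<le> 1" "x = p + t *\<^sub>R u" "c \<bullet> x = c \<bullet> v + c \<bullet> u"
      by (auto simp: mem_plus_symmetric_segment)
    then have "c \<bullet> p + t * (c \<bullet> u) = c \<bullet> v + c \<bullet> u"
      by (simp add: inner_add_right)
    with c[of p] le[of t] p have "c \<bullet> p = c \<bullet> v" "t * (c \<bullet> u) = c \<bullet> u"
      by linarith+
    with p \<open>0 < c \<bullet> u\<close> show "x \<in> (+) u ` ?F"
      by (auto simp: add.commute)
  next
    fix x assume "x \<in> (+) u ` ?F"
    then show "x \<in> ?G"
      by (auto simp: mem_plus_symmetric_segment inner_add_right intro!: exI[of _ 1])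
  qed
  moreover have "v \<in> ?F"
    using v vertices_subset by auto
  ultimately have "u + v extreme_point_of ?P'"
    using v extreme_point_of_face extreme_point_of_translation_eq by (metis vertices_def mem_Collect_eq)
  then show ?thesis
    by (simp add: vertices_def add.commute)
qed

text \<open>A vertex of a polytope is exposed by some \<open>c\<close>, and the sign of
  \<open>c \<bullet> u\<close> decides which translate is a vertex. If
  \<open>c \<bullet> u = 0\<close>, the maximal face of the sum is the segment from
  \<open>v - u\<close> to \<open>v + u\<close>, with both ends as vertices.\<close>

lemma vertex_plus_or_minus_segment:
  fixes P :: "'a::euclidean_space set"
  assumes "polytope P" and v: "v \<in> vertices P"
  shows "v + u \<in> vertices (P + closed_segment (- u) u) \<or> v - u \<in> vertices (P + closed_segment (- u) u)"
    (is "_ \<in> vertices ?P' \<or> _")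
proof -
  have "{v} exposed_face_of P"
    using assms by (simp add: exposed_face_of_polyhedron polytope_imp_polyhedron face_of_singleton vertices_def)
  then obtain c b where cb: "P \<subseteq> {x. c \<bullet> x \<le> b}" "{v} = P \<inter> {x. c \<bullet> x = b}"
    by (auto simp: exposed_face_of_def)
  then have "c \<bullet> v = b"
    by blast
  with cb have c: "c \<bullet> x \<le> c \<bullet> v" and c_eq: "c \<bullet> x = c \<bullet> v \<longleftrightarrow> x = v" if "x \<in> P" for x
    using that by blast+
  have vP: "v \<in> P" and cvx: "convex P"
    using assms vertices_subset by (auto simp: polytope_imp_convex)
  consider "c \<bullet> u > 0" | "c \<bullet> (- u) > 0" | "c \<bullet> u = 0"
    by fastforce
  then show ?thesis
  proof cases
    case 1
    then show ?thesis
      using vertex_plus_segment[OF cvx v c] by blast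
  next
    case 2
    then show ?thesis
      using vertex_plus_segment[OF cvx v c, of "- u"] by (simp add: closed_segment_commute)
  next
    case 3
    let ?G = "?P' \<inter> {x. c \<bullet> x = c \<bullet> v}"
    have "?G face_of ?P'"
    proof (rule face_of_Int_supporting_hyperplane_le)
      show "convex ?P'"
        using cvx by (intro convex_set_plus) auto
      show "c \<bullet> x \<le> c \<bullet> v" if "x \<in> ?P'" for x
        using that c 3 by (auto simp: mem_plus_symmetric_segment inner_add_right)
    qed
    moreover have "?G = (+) v ` closed_segment (- u) u"
    proof (intro subset_antisym subsetI)
      fix x assume "x \<in> ?G"
      then obtain p t where "p \<in> P" "\<bar>t\<bar> \<le> 1" "x = p + t *\<^sub>R u" "c \<bullet> x = c \<bullet> v"
        by (auto simp: mem_plus_symmetric_segment)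
      with 3 c_eq[of p] show "x \<in> (+) v ` closed_segment (- u) u"
        by (auto simp: symmetric_segment_eq inner_add_right abs_le_iff intro!: imageI)
    next
      fix x assume "x \<in> (+) v ` closed_segment (- u) u"
      with vP 3 show "x \<in> ?G"
        by (auto simp: symmetric_segment_eq inner_add_right)
    qed
    moreover have "v + u extreme_point_of (+) v ` closed_segment (- u) u"
      by (simp add: extreme_point_of_translation_eq extreme_point_of_segment)
    ultimately show ?thesis
      using extreme_point_of_face by (metis vertices_def mem_Collect_eq)
  qed
qed

lemma vertex_comb_subset_plus_segment:
  fixes P :: "'a::euclidean_space set"
  assumes P: "polytope P" and l: "0 \<le> l" "l \<le> 1 / 2"
  shows "vertex_comb l P \<subseteq> vertex_comb l (P + closed_segment (- u) u)"
proof
  fix x assume "x \<in> vertex_comb l P"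
  then obtain p v where p: "p \<in> P" and v: "v \<in> vertices P" and xe: "x = (1 - l) *\<^sub>R p + l *\<^sub>R v"
    by (auto simp: mem_vertex_comb)
  have "x \<in> vertex_comb l (P + closed_segment (- u) u)"
    if w: "v + s *\<^sub>R u \<in> vertices (P + closed_segment (- u) u)" and "\<bar>s\<bar> = 1" for s
  proof -
    \<comment> \<open>Shifting \<open>p\<close> by \<open>k u\<close> cancels the shift of the
      vertex by \<open>s u\<close>; \<open>l \<le> 1/2\<close> keeps \<open>k\<close> in
      [-1, 1].\<close>
    define k where "k = - s * l / (1 - l)"
    have "\<bar>k\<bar> \<le> 1" "(1 - l) * k = - (l * s)"
      using l that by (simp_all add: k_def abs_mult)
    then have "p + k *\<^sub>R u \<in> P + closed_segment (- u) u" "x = (1 - l) *\<^sub>R (p + k *\<^sub>R u) + l *\<^sub>R (v + s *\<^sub>R u)"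
      using p by (auto simp: mem_plus_symmetric_segment xe scaleR_add_right)
    then show ?thesis
      using w by (auto simp: mem_vertex_comb)
  qed
  from this[of 1] this[of "-1"] vertex_plus_or_minus_segment[OF P v, of u]
  show "x \<in> vertex_comb l (P + closed_segment (- u) u)"
    by auto
qed

section \<open>Leaving a polytope along a ray\<close>

text \<open>Otherwise a short step from \<open>a\<close> along \<open>u\<close> would violate none
  of the finitely many constraints: slack ones survive by continuity, and tight ones do not increase
  along \<open>u\<close>.\<close>

lemma tight_halfspace:
  fixes c :: "'h \<Rightarrow> 'a::real_inner"
  assumes "finite H" and a: "\<And>h. h \<in> H \<Longrightarrow> c h \<bullet> a \<le> b h"
    and out: "\<And>t. t > 0 \<Longrightarrow> \<exists>h\<in>H. c h \<bullet> (a + t *\<^sub>R u) > b h"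
  obtains h where "h \<in> H" "c h \<bullet> a = b h" "c h \<bullet> u > 0"
proof (rule ccontr)
  assume "\<not> thesis"
  then have no: "c h \<bullet> u \<le> 0" if "h \<in> H" "c h \<bullet> a = b h" for h
    using that \<open>\<And>h. \<lbrakk>h \<in> H; c h \<bullet> a = b h; c h \<bullet> u > 0\<rbrakk> \<Longrightarrow> thesis\<close> by (meson not_le)
  have "\<forall>\<^sub>F t in at_right 0. c h \<bullet> (a + t *\<^sub>R u) \<le> b h" if "h \<in> H" for h
  proof (cases "c h \<bullet> a = b h")
    case True
    with no that have "c h \<bullet> u \<le> 0"
      by simp
    with True show ?thesis
      by (auto simp: eventually_at_right_field inner_add_right mult_nonneg_nonpos intro!: exI[of _ 1])
  next
    case False
    have "((\<lambda>t. c h \<bullet> (a + t *\<^sub>R u)) \<longlongrightarrow> c h \<bullet> (a + 0 *\<^sub>R u)) (at_right 0)"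
      by (intro tendsto_intros)
    moreover have "c h \<bullet> (a + 0 *\<^sub>R u) < b h"
      using False a[OF that] by simp
    ultimately show ?thesis
      by (auto dest!: order_tendstoD(2) elim: eventually_mono)
  qed
  with \<open>finite H\<close> have "\<forall>\<^sub>F t in at_right 0. \<forall>h\<in>H. c h \<bullet> (a + t *\<^sub>R u) \<le> b h"
    by (simp add: eventually_ball_finite)
  moreover have "\<forall>\<^sub>F t in at_right (0::real). 0 < t"
    by (simp add: eventually_at_right_less)
  ultimately have "\<forall>\<^sub>F t in at_right (0::real). False"
    by eventually_elim (use out in force)
  then show False
    by simp
qed

lemma exit_point_vertex:
  fixes P :: "'a::euclidean_space set"
  assumes P: "polytope P" and l: "0 < l" "l < 1"
    and gen: "P \<subseteq> vertex_comb l P \<or>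
      aff_dim P = int DIM('a) \<and> (\<forall>F. F facet_of P \<longrightarrow> F \<subseteq> vertex_comb l F)"
    and a: "a \<in> P" and out: "\<And>t. t > 0 \<Longrightarrow> a + t *\<^sub>R u \<notin> P"
  obtains q v c where "q \<in> P" "v \<in> vertices P" "a = (1 - l) *\<^sub>R q + l *\<^sub>R v"
    "\<And>x. x \<in> P \<Longrightarrow> c \<bullet> x \<le> c \<bullet> v" "c \<bullet> u > 0"
proof -
  have "\<exists>F c b. F face_of P \<and> F = P \<inter> {x. c \<bullet> x = b} \<and> P \<subseteq> {x. c \<bullet> x \<le> b} \<and> a \<in> F
      \<and> c \<bullet> u > 0 \<and> F \<subseteq> vertex_comb l F"
    using gen
  proof (elim disjE conjE)
    assume gen: "P \<subseteq> vertex_comb l P"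
    \<comment> \<open>Any finite description by halfspaces serves here, because every face inherits
      the covering from \<open>P\<close>. The tight face need not be a facet and may be
      \<open>P\<close> itself.\<close>
    obtain H where H: "finite H" "P = \<Inter>H" "\<forall>h\<in>H. \<exists>c b. c \<noteq> 0 \<and> h = {x. c \<bullet> x \<le> b}"
      using P polytope_imp_polyhedron unfolding polyhedron_def by metis
    then obtain c b where cb: "\<And>h. h \<in> H \<Longrightarrow> h = {x. c h \<bullet> x \<le> b h}"
      by metis
    have memP: "x \<in> P \<longleftrightarrow> (\<forall>h\<in>H. c h \<bullet> x \<le> b h)" for x
      using H(2) cb by auto
    obtain h where h: "h \<in> H" "c h \<bullet> a = b h" "c h \<bullet> u > 0"
      using a out by (rule_tac tight_halfspace[of H c a b u, OF \<open>finite H\<close>]) (auto simp: memP not_le)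
    have face: "P \<inter> {x. c h \<bullet> x = b h} face_of P"
      using P h by (intro face_of_Int_supporting_hyperplane_le) (auto simp: polytope_imp_convex memP)
    then have "P \<inter> {x. c h \<bullet> x = b h} \<subseteq> vertex_comb l (P \<inter> {x. c h \<bullet> x = b h})"
      using vertex_comb_face[OF face l] gen by blast
    with face h a show ?thesis
      by (intro exI[of _ "P \<inter> {x. c h \<bullet> x = b h}"] exI[of _ "c h"] exI[of _ "b h"]) (auto simp: memP)
  next
    assume full: "aff_dim P = int DIM('a)" and gen: "\<forall>F. F facet_of P \<longrightarrow> F \<subseteq> vertex_comb l F"
    from P have "polyhedron P"
      by (rule polytope_imp_polyhedron)
    \<comment> \<open>The family must be irredundant here, so that each bounding hyperplane cuts out
      a facet.\<close>
    then obtain H where H: "finite H" "P = affine hull P \<inter> \<Inter>H"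
      "\<forall>h\<in>H. \<exists>c b. c \<noteq> 0 \<and> h = {x. c \<bullet> x \<le> b}"
      "\<forall>H'. H' \<subset> H \<longrightarrow> P \<subset> affine hull P \<inter> \<Inter>H'"
      unfolding polyhedron_Int_affine_minimal by metis
    from H(3) obtain c b where cb: "\<And>h. h \<in> H \<Longrightarrow> c h \<noteq> 0 \<and> h = {x. c h \<bullet> x \<le> b h}"
      by metis
    have "affine hull P = UNIV"
      using full by (simp add: aff_dim_eq_full)
    then have memP: "x \<in> P \<longleftrightarrow> (\<forall>h\<in>H. c h \<bullet> x \<le> b h)" for x
      using H(2) cb by auto
    obtain h where h: "h \<in> H" "c h \<bullet> a = b h" "c h \<bullet> u > 0"
      using a out by (rule_tac tight_halfspace[of H c a b u, OF \<open>finite H\<close>]) (auto simp: memP not_le)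
    have "P \<inter> {x. c h \<bullet> x = b h} facet_of P"
      using facet_of_polyhedron_explicit[OF H(1,2) cb] H(4) h(1) by blast
    with gen h a show ?thesis
      by (intro exI[of _ "P \<inter> {x. c h \<bullet> x = b h}"] exI[of _ "c h"] exI[of _ "b h"])
        (auto simp: memP facet_of_def)
  qed
  then obtain F c b where F: "F face_of P" "F = P \<inter> {x. c \<bullet> x = b}" "P \<subseteq> {x. c \<bullet> x \<le> b}"
    "c \<bullet> u > 0" "a \<in> vertex_comb l F"
    by blast
  then obtain q v where qv: "q \<in> F" "v \<in> vertices F" "a = (1 - l) *\<^sub>R q + l *\<^sub>R v"
    by (auto simp: mem_vertex_comb)
  then have "v \<in> vertices P" "v \<in> F"
    using extreme_point_of_face[OF F(1)] by (auto simp: vertices_def)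
  then show ?thesis
    using F qv by (intro that[of q v c]) auto
qed

text \<open>Compactness gives a last parameter within \<open>[0, t]\<close>. Convexity excludes a
  return to \<open>P\<close> even beyond \<open>t\<close>.\<close>

lemma last_point_on_ray:
  fixes P :: "'a::real_normed_vector set"
  assumes P: "convex P" "compact P" and p: "p \<in> P" and "0 \<le> t" and out: "p + t *\<^sub>R u \<notin> P"
  obtains s where "0 \<le> s" "s < t" "p + s *\<^sub>R u \<in> P" "\<And>r. r > 0 \<Longrightarrow> p + (s + r) *\<^sub>R u \<notin> P"
proof -
  let ?S = "{0..t} \<inter> (\<lambda>s. p + s *\<^sub>R u) -` P"
  have "closed ((\<lambda>s. p + s *\<^sub>R u) -` P)"
    using compact_imp_closed[OF P(2)] by (intro closed_vimage continuous_intros)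
  then have "compact ?S"
    by (simp add: compact_Int_closed)
  moreover have "0 \<in> ?S"
    using p \<open>0 \<le> t\<close> by simp
  ultimately obtain s where s: "s \<in> ?S" "\<And>r. r \<in> ?S \<Longrightarrow> r \<le> s"
    using compact_attains_sup[of ?S] by blast
  have st: "s < t"
    using s(1) out by (cases "s = t") auto
  have "p + (s + r) *\<^sub>R u \<notin> P" if "r > 0" for r
  proof
    assume r: "p + (s + r) *\<^sub>R u \<in> P"
    \<comment> \<open>Truncating \<open>r\<close> keeps \<open>s + k\<close> in
      \<open>[0, t]\<close>, where \<open>s\<close> is maximal.\<close>
    define k where "k = min r (t - s)"
    have k: "0 < k" "k \<le> r" "s + k \<le> t"
      using \<open>r > 0\<close> st by (auto simp: k_def)
    have "(1 - k / r) *\<^sub>R (p + s *\<^sub>R u) + (k / r) *\<^sub>R (p + (s + r) *\<^sub>R u) \<in> P"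
      using P(1) s(1) r k by (intro convexD) auto
    moreover have "(1 - k / r) *\<^sub>R (p + s *\<^sub>R u) + (k / r) *\<^sub>R (p + (s + r) *\<^sub>R u) = p + (s + k) *\<^sub>R u"
      using \<open>r > 0\<close> by (simp add: algebra_simps)
    ultimately have "s + k \<in> ?S"
      using s(1) k by simp
    with s(2) k show False
      by fastforce
  qed
  with st s(1) show ?thesis
    by (intro that[of s]) auto
qed

lemma outside_subset_vertex_comb:
  fixes P :: "'a::euclidean_space set"
  assumes P: "polytope P" and l: "0 < l" "l \<le> 1 / 2"
    and gen: "P \<subseteq> vertex_comb l P \<or>
      aff_dim P = int DIM('a) \<and> (\<forall>F. F facet_of P \<longrightarrow> F \<subseteq> vertex_comb l F)"
    and x: "x \<in> P + closed_segment (- u) u" "x \<notin> P"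
  shows "x \<in> vertex_comb l (P + closed_segment (- u) u)"
proof -
  have "l < 1"
    using l by simp
  \<comment> \<open>Taking \<open>w = u\<close> or \<open>w = - u\<close>, which give the same
    segment, allows a nonnegative coefficient.\<close>
  have up: "x \<in> vertex_comb l (P + closed_segment (- w) w)"
    if p: "p \<in> P" and t: "0 \<le> t" "t \<le> 1" and xe: "x = p + t *\<^sub>R w" for p t w
  proof -
    have "p + t *\<^sub>R w \<notin> P"
      using x xe by simp
    then obtain s where s: "0 \<le> s" "s < t" "p + s *\<^sub>R w \<in> P"
      "\<And>r. r > 0 \<Longrightarrow> p + (s + r) *\<^sub>R w \<notin> P"
      using last_point_on_ray[of P p t w] P p t polytope_imp_convex polytope_imp_compact by metis
    have "(p + s *\<^sub>R w) + r *\<^sub>R w \<notin> P" if "r > 0" for r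
      using s(4)[OF that] by (simp add: algebra_simps)
    then obtain q v c where qv: "q \<in> P" "v \<in> vertices P" "p + s *\<^sub>R w = (1 - l) *\<^sub>R q + l *\<^sub>R v"
      and c: "\<And>x. x \<in> P \<Longrightarrow> c \<bullet> x \<le> c \<bullet> v" "c \<bullet> w > 0"
      using exit_point_vertex[OF P l(1) \<open>l < 1\<close> gen s(3)] by metis
    have vw: "v + w \<in> vertices (P + closed_segment (- w) w)"
      using vertex_plus_segment[OF polytope_imp_convex[OF P] qv(2) c] .
    \<comment> \<open>Solves \<open>(1 - l) k + l = t - s\<close>. From
      \<open>0 < t - s \<le> 1\<close> and \<open>l \<le> 1/2\<close> it follows that
      \<open>k\<close> lies in [-1, 1].\<close>
    define k where "k = (t - s - l) / (1 - l)"
    have "\<bar>k\<bar> \<le> 1"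
      using s t l by (auto simp: k_def divide_simps abs_le_iff)
    then have qk: "q + k *\<^sub>R w \<in> P + closed_segment (- w) w"
      using qv by (auto simp: mem_plus_symmetric_segment)
    have "x = (p + s *\<^sub>R w) + (t - s) *\<^sub>R w"
      by (simp add: xe algebra_simps)
    also have "\<dots> = (1 - l) *\<^sub>R q + l *\<^sub>R v + ((1 - l) * k + l) *\<^sub>R w"
      using qv(3) l by (simp add: k_def)
    also have "\<dots> = (1 - l) *\<^sub>R (q + k *\<^sub>R w) + l *\<^sub>R (v + w)"
      by (simp add: algebra_simps)
    finally show ?thesis
      using qk vw by (auto simp: mem_vertex_comb)
  qed
  obtain p t where p: "p \<in> P" "\<bar>t\<bar> \<le> 1" "x = p + t *\<^sub>R u"
    using x(1) by (auto simp: mem_plus_symmetric_segment)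
  show ?thesis
  proof (cases "0 \<le> t")
    case True
    then show ?thesis
      using up[of p t u] p by simp
  next
    case False
    then show ?thesis
      using up[of p "- t" "- u"] p by (simp add: closed_segment_commute)
  qed
qed

text \<open>Below dimension \<open>n - 1\<close> the condition on faces is vacuous and the inclusion
  can fail: take a triangle in 4-space, \<open>l = 1/2\<close> and a segment orthogonal to its
  plane. The last assumption covers these dimensions.\<close>

theorem theorem3p1:
  fixes P :: "(real ^ 'n) set" and l :: real
  assumes "1 / (real CARD('n) + 1) \<le> l" and "l \<le> 1 / 2"
    and "polytope P"
    and "\<And>F. F face_of P \<Longrightarrow> aff_dim F = int CARD('n) - 1 \<Longrightarrow> vertex_generated l F"
    and "aff_dim P < int CARD('n) - 1 \<Longrightarrow> vertex_generated l P"
  shows "(\<forall>u. let P' = P + closed_segment (- u) u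
              in P' - vertex_comb l P' \<subseteq> P - vertex_comb l P)
    \<and> (vertex_generated l P \<longrightarrow> (\<forall>a b. vertex_generated l (P + closed_segment a b)))"
proof -
  note P = \<open>polytope P\<close>
  have l: "0 < l" "0 \<le> l" "l \<le> 1 / 2" "l < 1"
    using assms(1,2) less_le_trans[of 0 "1 / (real CARD('n) + 1)" l] by auto
  have gen: "P \<subseteq> vertex_comb l P \<or>
      aff_dim P = int DIM(real ^ 'n) \<and> (\<forall>F. F facet_of P \<longrightarrow> F \<subseteq> vertex_comb l F)"
  proof (cases "aff_dim P = int CARD('n)")
    case True
    then show ?thesis
      using assms(4) vertex_generated_iff[OF face_of_polytope_polytope[OF P] l(2,4)]
      by (auto simp: facet_of_def)
  next
    case False
    \<comment> \<open>In dimension \<open>n - 1\<close>, \<open>P\<close> is one of its own faces,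
      so the condition on faces applies to \<open>P\<close>.\<close>
    moreover have "aff_dim P \<le> int CARD('n)"
      using aff_dim_le_DIM[of P] by simp
    ultimately have "vertex_generated l P"
      using assms(4)[of P] assms(5) P by (force simp: face_of_refl polytope_imp_convex)
    then show ?thesis
      using vertex_generated_iff[OF P l(2,4)] by simp
  qed
  have main: "P + closed_segment (- u) u - vertex_comb l (P + closed_segment (- u) u)
      \<subseteq> P - vertex_comb l P" for u
    using outside_subset_vertex_comb[OF P l(1,3) gen] vertex_comb_subset_plus_segment[OF P l(2,3)]
    by blast
  have "vertex_generated l (P + closed_segment a b)" if "vertex_generated l P" for a b
  proof -
    define m u where "m = (1 / 2) *\<^sub>R (a + b)" and "u = (1 / 2) *\<^sub>R (b - a)"
    have "a = m + (- u)" "b = m + u"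
      by (simp_all add: m_def u_def algebra_simps flip: scaleR_add_left)
    then have "closed_segment a b = (+) m ` closed_segment (- u) u"
      by (metis closed_segment_translation)
    then have eq: "P + closed_segment a b = (+) m ` (P + closed_segment (- u) u)"
      by (fastforce simp: set_plus_def image_iff add.left_commute)
    have "P + closed_segment (- u) u \<subseteq> vertex_comb l (P + closed_segment (- u) u)"
      using main[of u] that vertex_generated_iff[OF P l(2,4)] by blast
    then have "P + closed_segment a b \<subseteq> vertex_comb l (P + closed_segment a b)"
      unfolding eq vertex_comb_translation by blast
    moreover have "polytope (P + closed_segment a b)"
      using P by (simp add: polytope_plus segment_convex_hull polytope_convex_hull)
    ultimately show ?thesis
      using vertex_generated_iff l(2,4) by blast
  qed
  with main show ?thesis
    by (simp add: Let_def)
qed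

end
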